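(* Let $N\in\mathbb{N}$ and let $\rho=(\rho_1,\ldots,\rho_m)$ be a composition of $N$. Then $$\sum_{k\ge 0}\left(\prod_{j=1}^{m}\binom{\rho_j+k}{k}_q\right)x^k=\frac{\sum_{w\in S_\rho}x^{\mathrm{mstc}(w)}q^{\mathrm{inv}(w)}}{\prod_{i=0}^{N}(1-xq^i)}\quad\text{in }\mathbb{Z}[q][[x]].$$
   Context: A composition $\rho=(\rho_1,\ldots,\rho_m)$ of $N$ is a finite sequence of positive integers with sum $N$. $[n]=\{1,\ldots,n\}$. $q$-binomials: $[n]_q=\sum_{i=0}^{n-1}q^i$, $[n]_q!=\prod_{i=1}^n[i]_q$, $[0]_q!=1$, $\binom{n}{k}_q=\frac{[n]_q!}{[n-k]_q!\,[k]_q!}$. $S_\rho$ is the set of all permutations (rearrangements) $w=w_1\cdots w_N$ of the multiset $\{1^{\rho_1},\ldots,m^{\rho_m}\}$. For $w\in S_\rho$, $\mathrm{inv}(w)=|\{(i,j) : 1\le i<j\le N,\ w_i>w_j\}|$. Standardisation: for $w\in S_\rho$, $\mathrm{std}(w)\in S_N$ is the permutation (in one-line notation) obtained from $w$ by replacing, in order of appearance from left to right, the $\rho_1$ letters $1$ by $1,2,\ldots,\rho_1$, the $\rho_2$ letters $2$ by $\rho_1+1,\ldots,\rho_1+\rho_2$, and so on. (E.g. for $\rho=(2,3,2)$, $\mathrm{std}(1223132)=1346275$.) Put $\mathrm{istd}(w):=(\mathrm{std}(w))^{-1}\in S_N$. The statistic stc: the code of $\sigma\in S_n$ is the word $\mathrm{code}(\sigma)=c_1\cdots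 c_n$ with $c_i=|\{j : i<j\le n,\ \sigma(i)>\sigma(j)\}|$. For a word $w=w_1\cdots w_n$ of nonnegative integers with $w_i\le n-i$, $\mathrm{st}(w)$ is the largest $r\in[n]$ for which there exist indices $i_1<\cdots<i_r$ such that $w_{i_1}\cdots w_{i_r}>(r-1)(r-2)\cdots 1\,0$ componentwise and strictly, i.e. $w_{i_j}>r-j$ for all $j=1,\ldots,r$; $\mathrm{st}(w)=0$ if no such $r$ exists. Then $\mathrm{stc}(\sigma):=\mathrm{st}(\mathrm{code}(\sigma))$. Multistc: for $w\in S_\rho$, $\mathrm{mstc}(w):=\mathrm{stc}(\mathrm{istd}(w))$. *)

theory Defs
  imports
    "HOL-Computational_Algebra.Computational_Algebra"
    "HOL-Combinatorics.Combinatorics"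
begin

definition is_composition :: "nat list \<Rightarrow> nat \<Rightarrow> bool" where
  "is_composition \<rho> N \<longleftrightarrow> (\<forall>a\<in>set \<rho>. 0 < a) \<and> sum_list \<rho> = N"

(* Lists are indexed from 0 in the library; w\<langle>i\<rangle> is the i-th entry counted from 1. *)
abbreviation entry :: "'a list \<Rightarrow> nat \<Rightarrow> 'a" ("_\<langle>_\<rangle>" [1000, 0] 1000) where
  "w\<langle>i\<rangle> \<equiv> w ! (i - 1)"


subsection \<open>q-binomials in Z[q]\<close>

definition qvar :: "int poly" where
  "qvar = monom 1 1"

definition qint :: "nat \<Rightarrow> int poly" where
  "qint n = (\<Sum>i<n. qvar ^ i)"

definition qfact :: "nat \<Rightarrow> int poly" where
  "qfact n = (\<Prod>i=1..n. qint i)"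

(* Meant for k \<le> n. The polynomial division is exact, see qbinom_mult below. *)
definition qbinom :: "nat \<Rightarrow> nat \<Rightarrow> int poly" where
  "qbinom n k = qfact n div (qfact (n - k) * qfact k)"

lemma qint_add: "qint (a + b) = qint a + qvar ^ a * qint b"
proof -
  have "qint (a + b) = (\<Sum>i<a. qvar ^ i) + (\<Sum>i<b. qvar ^ (a + i))"
    unfolding qint_def by (induction b) (simp_all add: add.assoc)
  then show ?thesis
    by (simp add: qint_def power_add sum_distrib_left)
qed

lemma qfact_Suc: "qfact (Suc n) = qint (Suc n) * qfact n"
  by (simp add: qfact_def mult.commute)

lemma qfact_dvd: "qfact a * qfact b dvd qfact (a + b)"
proof (induction "a + b" arbitrary: a b)
  case 0
  then show ?case by (simp add: qfact_def)
next
  case (Suc n)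
  show ?case
  proof (cases "a = 0 \<or> b = 0")
    case True
    then show ?thesis by (auto simp: qfact_def)
  next
    case False
    then obtain c d where cd: "a = Suc c" "b = Suc d"
      by (metis not0_implies_Suc)
    have n: "c + b = n" "a + d = n" using Suc.hyps(2) cd by auto
    have "qfact c * qfact b dvd qfact n" "qfact a * qfact d dvd qfact n"
      using Suc.hyps(1)[of c b] Suc.hyps(1)[of a d] n by simp_all
    then have "qint a * (qfact c * qfact b) dvd qint a * qfact n"
      "(qvar ^ a * qint b) * (qfact a * qfact d) dvd (qvar ^ a * qint b) * qfact n"
      by (simp_all only: mult_dvd_mono dvd_refl)
    moreover have "qint a * (qfact c * qfact b) = qfact a * qfact b"
      using cd by (simp add: qfact_Suc mult.assoc)
    moreover have "(qvar ^ a * qint b) * (qfact a * qfact d) = qvar ^ a * (qfact a * qfact b)"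
      using cd by (simp add: qfact_Suc ac_simps)
    ultimately have "qfact a * qfact b dvd qint a * qfact n + (qvar ^ a * qint b) * qfact n"
      by (metis dvd_add dvd_mult_right)
    moreover have "qfact (a + b) = qint a * qfact n + (qvar ^ a * qint b) * qfact n"
      using Suc.hyps(2) qfact_Suc[of n] qint_add[of a b] by (simp add: distrib_right)
    ultimately show ?thesis by simp
  qed
qed

lemma qbinom_mult:
  assumes "k \<le> n"
  shows "qbinom n k * (qfact (n - k) * qfact k) = qfact n"
  using qfact_dvd[of "n - k" k] assms by (simp add: qbinom_def)


subsection \<open>Words and statistics\<close>

definition multiset_words :: "nat list \<Rightarrow> nat list set" where
  "multiset_words \<rho> =
     permutations_of_multiset (\<Sum>j=1..length \<rho>. replicate_mset (\<rho>\<langle>j\<rangle>) j)"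

definition word_inv :: "nat list \<Rightarrow> nat" where
  "word_inv w = card {(i, j). 1 \<le> i \<and> i < j \<and> j \<le> length w \<and> w\<langle>i\<rangle> > w\<langle>j\<rangle>}"

(* Permutations of {1..N} are functions nat \<Rightarrow> nat that are the identity outside {1..N}
   (as for the library predicate permutes), so that inv is the inverse in the symmetric group.
   The t-th occurrence of the letter a in w is replaced by \<rho>\<langle>1\<rangle> + ... + \<rho>\<langle>a-1\<rangle> + t. *)
definition std :: "nat list \<Rightarrow> nat list \<Rightarrow> nat \<Rightarrow> nat" where
  "std \<rho> w i =
     (if i \<in> {1..length w}
      then (\<Sum>b = 1..<w\<langle>i\<rangle>. \<rho>\<langle>b\<rangle>) + card {j\<in>{1..i}. w\<langle>j\<rangle> = w\<langle>i\<rangle>}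
      else i)"

definition istd :: "nat list \<Rightarrow> nat list \<Rightarrow> nat \<Rightarrow> nat" where
  "istd \<rho> w = inv (std \<rho> w)"

definition perm_code :: "nat \<Rightarrow> (nat \<Rightarrow> nat) \<Rightarrow> nat list" where
  "perm_code n \<sigma> = map (\<lambda>i. card {j. i < j \<and> j \<le> n \<and> \<sigma> i > \<sigma> j}) [1..<n + 1]"

definition dominates_staircase :: "nat list \<Rightarrow> nat \<Rightarrow> bool" where
  "dominates_staircase w r \<longleftrightarrow>
     (\<exists>\<iota>. strict_mono_on {1..r} \<iota> \<and> \<iota> ` {1..r} \<subseteq> {1..length w} \<and>
          (\<forall>j\<in>{1..r}. w\<langle>\<iota> j\<rangle> > r - j))"

definition st :: "nat list \<Rightarrow> nat" where
  "st w = (if \<exists>r\<in>{1..length w}. dominates_staircase w r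
           then Max {r\<in>{1..length w}. dominates_staircase w r} else 0)"

definition stc :: "nat \<Rightarrow> (nat \<Rightarrow> nat) \<Rightarrow> nat" where
  "stc n \<sigma> = st (perm_code n \<sigma>)"

definition mstc :: "nat list \<Rightarrow> nat list \<Rightarrow> nat" where
  "mstc \<rho> w = stc (sum_list \<rho>) (istd \<rho> w)"


subsection \<open>The denominator in Z[q][[x]]\<close>

definition denom :: "nat \<Rightarrow> int poly fps" where
  "denom N = (\<Prod>i=0..N. 1 - fps_X * fps_const (qvar ^ i))"

(* The coefficient ring Z[q] is not a field, so the type class division of power series is
   unavailable; the reciprocal is the library's fps_right_inverse D c, for which c must be the
   reciprocal of the constant coefficient of D, here 1. *)
definition inverse_denom :: "nat \<Rightarrow> int poly fps" where
  "inverse_denom N = fps_right_inverse (denom N) 1"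

lemma denom_mult_inverse: "denom N * inverse_denom N = 1"
proof -
  have "fps_nth (denom N) 0 = 1"
    unfolding denom_def by (induction N) simp_all
  then show ?thesis
    unfolding inverse_denom_def by (intro fps_right_inverse) simp
qed

end

theory Submission
  imports Defs
begin

text \<open>
  The code of \<open>istd w\<close> can be read off from \<open>w\<close>: run through the letters in increasing order and
  through the occurrences of each letter from left to right, and record for each occurrence the
  number of larger letters to its left (\<open>perm_code_istd\<close>). Its entries add up to \<open>inv w\<close>. The
  statistic \<open>st\<close> of a code is the result of a greedy scan from right to left: start at level 0 and
  go up one level at every entry that exceeds the current level (\<open>st_eq_climb\<close>). Both statistics are
  therefore compatible with deleting all copies of the smallest letter of \<open>w\<close>: this removes an
  initial segment of the code, and the scan of that segment starts from the level that the remaining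
  word has reached.

  On the other side, the reciprocal of the denominator \<open>\<Prod>i\<le>N. (1 - x q^i)\<close> is
  \<open>\<Sum>k. binom (N + k) k x^k\<close> (\<open>inverse_denom_eq_gauss_series\<close>). With this, the
  induction on the number of letters comes down to the following statement about a single letter.
  Let \<open>u\<close> be a word of length \<open>m\<close> with statistic \<open>s\<close>. Inserting \<open>b\<close> copies of a new smallest
  letter in all possible ways replaces the term \<open>x^s\<close> of the numerator by a polynomial
  \<open>P b m s\<close>, and the quotient of \<open>P b m s\<close> by the denominator of order \<open>m + b\<close> must be obtained
  from the quotient of \<open>x^s\<close> by the denominator of order \<open>m\<close> through multiplication of the
  coefficient of each \<open>x^k\<close> by \<open>binom (b + k) k\<close>
  (\<open>insertion_weight_mult_gauss_series\<close>).

  Both sides of this statement satisfy one recurrence. According to the last letter of the extended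
  word, \<open>P b m s = P b (m - 1) s + q^m P (b - 1) m (s + 1)\<close> for \<open>s < m\<close>
  (\<open>insertion_weight_snoc_Suc\<close>), and two applications of the q-Pascal rule show that the
  power series on the other side match it (\<open>gauss_scale_recurrence\<close>). At the boundary
  \<open>s = m\<close> the scan cannot rise any more, so that \<open>P b s s\<close> is the monomial \<open>x^s\<close> times a
  q-binomial (\<open>insertion_weight_low\<close>), and the claim is the symmetry of the q-trinomial coefficients
  (\<open>gauss_scale_diagonal\<close>).
\<close>

section \<open>Gaussian binomials and their generating functions\<close>

text \<open>Indexing by the two sides of a box makes the q-binomial symmetric and keeps the arguments of
  \<open>qbinom\<close> inside their intended range.\<close>
definition gauss :: "nat \<Rightarrow> nat \<Rightarrow> int poly" where
  "gauss a b = qbinom (a + b) b"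

lemma qint_nonzero: "0 < n \<Longrightarrow> qint n \<noteq> 0"
proof -
  assume "0 < n"
  have "poly (qint n) 1 = int n"
    by (simp add: qint_def qvar_def poly_sum poly_monom)
  then show ?thesis using \<open>0 < n\<close> by auto
qed

lemma qfact_nonzero: "qfact n \<noteq> 0"
  by (simp add: qfact_def qint_nonzero)

lemma gauss_mult_qfact: "gauss a b * (qfact a * qfact b) = qfact (a + b)"
  using qbinom_mult[of b "a + b"] by (simp add: gauss_def)

lemma gauss_eqI: "p * (qfact a * qfact b) = qfact (a + b) \<Longrightarrow> gauss a b = p"
  using gauss_mult_qfact[of a b] qfact_nonzero
  by (metis mult_right_cancel no_zero_divisors)

lemma gauss_sym: "gauss a b = gauss b a"
  by (rule gauss_eqI) (metis gauss_mult_qfact mult.commute add.commute)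

lemma gauss_0_right [simp]: "gauss a 0 = 1"
  by (rule gauss_eqI) (simp add: qfact_def)

lemma gauss_0_left [simp]: "gauss 0 b = 1"
  by (rule gauss_eqI) (simp add: qfact_def)

text \<open>The q-Pascal rule, from splitting \<open>[a + b + 2]\<close> as \<open>[a + 1] + q^(a + 1) [b + 1]\<close> in the
  quotient of q-factorials.\<close>
lemma gauss_Suc_Suc:
  "gauss (Suc a) (Suc b) = gauss a (Suc b) + qvar ^ Suc a * gauss (Suc a) b"
proof (rule gauss_eqI)
  let ?A = "qfact (Suc a)" and ?B = "qfact (Suc b)"
  have 1: "gauss a (Suc b) * (?A * ?B) = qint (Suc a) * qfact (Suc (a + b))"
    using gauss_mult_qfact[of a "Suc b"] by (simp add: qfact_Suc[of a] ac_simps)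
  have 2: "gauss (Suc a) b * (?A * ?B) = qint (Suc b) * qfact (Suc (a + b))"
    using gauss_mult_qfact[of "Suc a" b] by (simp add: qfact_Suc[of b] ac_simps)
  have "(gauss a (Suc b) + qvar ^ Suc a * gauss (Suc a) b) * (?A * ?B)
      = gauss a (Suc b) * (?A * ?B) + qvar ^ Suc a * (gauss (Suc a) b * (?A * ?B))"
    by (simp only: distrib_right mult.assoc)
  also have "\<dots> = (qint (Suc a) + qvar ^ Suc a * qint (Suc b)) * qfact (Suc (a + b))"
    unfolding 1 2 by (simp only: distrib_right mult.assoc)
  also have "\<dots> = qfact (Suc a + Suc b)"
    using qint_add[of "Suc a" "Suc b"] qfact_Suc[of "Suc (a + b)"] by simp
  finally show "(gauss a (Suc b) + qvar ^ Suc a * gauss (Suc a) b) * (?A * ?B) =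
    qfact (Suc a + Suc b)" .
qed

lemma gauss_Suc_Suc':
  "gauss (Suc a) (Suc b) = gauss (Suc a) b + qvar ^ Suc b * gauss a (Suc b)"
  using gauss_Suc_Suc[of b a] by (simp add: gauss_sym)

text \<open>Both products are the q-multinomial coefficient with parts \<open>s\<close>, \<open>n\<close>, \<open>b\<close>; clearing the
  denominators reduces the identity to one between q-factorials.\<close>
lemma gauss_trinomial: "gauss s n * gauss b (n + s) = gauss b s * gauss (s + b) n"
proof -
  let ?c = "qfact s * qfact n * qfact b"
  have "gauss s n * gauss b (n + s) * (?c * qfact (n + s))
      = (gauss s n * (qfact s * qfact n)) * (gauss b (n + s) * (qfact b * qfact (n + s)))"
    by (simp only: ac_simps)
  also have "\<dots> = qfact (n + s) * qfact (b + (n + s))"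
    unfolding gauss_mult_qfact by (simp only: ac_simps)
  finally have 1: "gauss s n * gauss b (n + s) * ?c = qfact (b + (n + s))"
    using qfact_nonzero[of "n + s"] by (metis mult.assoc mult.commute mult_right_cancel)
  have "gauss b s * gauss (s + b) n * (?c * qfact (s + b))
      = (gauss b s * (qfact b * qfact s)) * (gauss (s + b) n * (qfact (s + b) * qfact n))"
    by (simp only: ac_simps)
  also have "\<dots> = qfact (s + b) * qfact (b + (n + s))"
    unfolding gauss_mult_qfact by (simp only: ac_simps)
  finally have 2: "gauss b s * gauss (s + b) n * ?c = qfact (b + (n + s))"
    using qfact_nonzero[of "s + b"] by (metis mult.assoc mult.commute mult_right_cancel)
  have "?c \<noteq> 0" using qfact_nonzero by simp
  then show ?thesis using 1 2 by (metis mult_right_cancel)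
qed

definition gauss_series :: "nat \<Rightarrow> int poly fps" where
  "gauss_series n = Abs_fps (gauss n)"

definition q_power :: "nat \<Rightarrow> int poly fps" where
  "q_power i = fps_const (qvar ^ i)"

lemma q_power_0 [simp]: "q_power 0 = 1"
  by (simp add: q_power_def)

lemma q_power_add: "q_power (i + j) = q_power i * q_power j"
  by (simp add: q_power_def power_add)

lemma nth_one_minus_X_q:
  "fps_nth ((1 - fps_X * q_power i) * f) k
    = fps_nth f k - (if k = 0 then 0 else qvar ^ i * fps_nth f (k - 1))"
  by (simp add: q_power_def left_diff_distrib mult.assoc)

lemma one_minus_X_q_nonzero: "1 - fps_X * q_power i \<noteq> 0"
proof
  assume "1 - fps_X * q_power i = 0"
  then have "fps_nth ((1 - fps_X * q_power i) * 1) 0 = 0" by simp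
  then show False by (simp only: nth_one_minus_X_q) simp
qed

lemma gauss_series_Suc:
  "(1 - fps_X * q_power (Suc n)) * gauss_series (Suc n) = gauss_series n"
proof (rule fps_ext)
  fix k
  show "fps_nth ((1 - fps_X * q_power (Suc n)) * gauss_series (Suc n)) k
      = fps_nth (gauss_series n) k"
    by (cases k) (simp_all only: nth_one_minus_X_q, simp_all add: gauss_series_def gauss_Suc_Suc)
qed

lemma denom_mult_gauss_series: "denom n * gauss_series n = 1"
proof (induction n)
  case 0
  have "(1 - fps_X * q_power 0) * gauss_series 0 = 1"
    by (rule fps_ext, simp only: nth_one_minus_X_q) (simp add: gauss_series_def)
  then show ?case by (simp add: denom_def)
next
  case (Suc n)
  have "denom (Suc n) = denom n * (1 - fps_X * q_power (Suc n))"
    by (simp add: denom_def q_power_def)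
  then show ?case using Suc by (simp add: mult.assoc gauss_series_Suc)
qed

lemma inverse_denom_eq_gauss_series: "inverse_denom n = gauss_series n"
proof -
  have "inverse_denom n = (denom n * gauss_series n) * inverse_denom n"
    by (simp add: denom_mult_gauss_series)
  also have "\<dots> = (denom n * inverse_denom n) * gauss_series n"
    by (simp only: ac_simps)
  finally show ?thesis by (simp add: denom_mult_inverse)
qed

text \<open>The coefficientwise product with \<open>\<Sum>k. gauss b k x^k\<close>. It adds the factor of one more part \<open>b\<close>
  of the composition to the left-hand side of the theorem.\<close>
definition gauss_scale :: "nat \<Rightarrow> int poly fps \<Rightarrow> int poly fps" where
  "gauss_scale b f = Abs_fps (\<lambda>k. fps_nth f k * gauss b k)"

lemma gauss_scale_sum: "gauss_scale b (\<Sum>i\<in>I. f i) = (\<Sum>i\<in>I. gauss_scale b (f i))"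
  by (rule fps_ext) (simp add: gauss_scale_def fps_sum_nth sum_distrib_right)

lemma gauss_scale_q_power: "gauss_scale b (q_power i * f) = q_power i * gauss_scale b f"
  by (rule fps_ext) (simp add: gauss_scale_def q_power_def mult.assoc)

lemma gauss_scale_0: "gauss_scale 0 f = f"
  by (rule fps_ext) (simp add: gauss_scale_def)

text \<open>The value at the boundary of the recurrence below, where the exponent of \<open>x\<close> equals the order of
  the series.\<close>
lemma gauss_scale_diagonal:
  "gauss_scale b (fps_X ^ s * gauss_series s)
    = fps_X ^ s * fps_const (gauss b s) * gauss_series (s + b)"
proof (rule fps_ext)
  fix k
  show "fps_nth (gauss_scale b (fps_X ^ s * gauss_series s)) k
      = fps_nth (fps_X ^ s * fps_const (gauss b s) * gauss_series (s + b)) k"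
  proof (cases "k < s")
    case False
    then obtain n where "k = n + s" by (metis le_add_diff_inverse2 not_less)
    then show ?thesis
      using gauss_trinomial[of s n b]
      by (simp add: gauss_scale_def gauss_series_def fps_X_power_mult_nth mult.assoc)
  qed (simp add: gauss_scale_def fps_X_power_mult_nth mult.assoc)
qed

text \<open>At the coefficient of \<open>x^(n + 1 + s)\<close>, the q-Pascal rule for \<open>gauss (m + 1) (n + 1)\<close> accounts
  for the first summand on the right, and the rule for \<open>gauss (b + 1) (n + 1 + s)\<close> for the second.\<close>
lemma gauss_scale_recurrence:
  "(1 - fps_X * q_power (Suc m + Suc b)) * gauss_scale (Suc b) (fps_X ^ s * gauss_series (Suc m))
    = gauss_scale (Suc b) (fps_X ^ s * gauss_series m)
      + q_power (Suc m) * gauss_scale b (fps_X ^ Suc s * gauss_series (Suc m))"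
    (is "?L = ?R")
proof (rule fps_ext)
  fix k
  consider "k < s" | "k = s" | n where "k = Suc n + s"
    by (metis add_Suc less_imp_Suc_add not_less_iff_gr_or_eq add.commute)
  then show "fps_nth ?L k = fps_nth ?R k"
  proof cases
    case 1
    then show ?thesis
      by (simp only: nth_one_minus_X_q)
        (simp add: gauss_scale_def q_power_def fps_X_power_mult_nth mult.assoc
          less_imp_diff_less del: power_Suc)
  next
    case 2
    then show ?thesis
      by (simp only: nth_one_minus_X_q)
        (simp add: gauss_scale_def gauss_series_def q_power_def fps_X_power_mult_nth mult.assoc
          del: power_Suc)
  next
    case 3
    have L: "fps_nth ?L k = gauss (Suc m) (Suc n) * gauss (Suc b) (Suc (n + s))
       - qvar ^ (Suc m + Suc b) * (gauss (Suc m) n * gauss (Suc b) (n + s))"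
      using 3 by (simp only: nth_one_minus_X_q)
        (simp add: gauss_scale_def gauss_series_def fps_X_power_mult_nth del: power_Suc)
    have R: "fps_nth ?R k = gauss m (Suc n) * gauss (Suc b) (Suc (n + s))
       + qvar ^ Suc m * (gauss (Suc m) n * gauss b (Suc (n + s)))"
      using 3 by (simp add: gauss_scale_def gauss_series_def q_power_def fps_X_power_mult_nth
          del: power_Suc)
    show ?thesis
      unfolding L R gauss_Suc_Suc[of m n] gauss_Suc_Suc[of b "n + s"] power_add
      by (simp only: algebra_simps)
  qed
qed

section \<open>The staircase statistic as a greedy scan\<close>

text \<open>The starting level is a parameter so that the scan of a concatenation can be resumed at the level
  reached on its right part.\<close>
definition climb :: "nat list \<Rightarrow> nat \<Rightarrow> nat" where
  "climb cs s = foldr (\<lambda>c r. if r < c then Suc r else r) cs s"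

lemma climb_Nil [simp]: "climb [] s = s"
  by (simp add: climb_def)

lemma climb_Cons: "climb (c # cs) s = (if climb cs s < c then Suc (climb cs s) else climb cs s)"
  by (simp add: climb_def)

lemma climb_append: "climb (cs @ ds) s = climb cs (climb ds s)"
  by (simp add: climb_def)

lemma climb_le_length: "climb cs 0 \<le> length cs"
  by (induction cs) (auto simp: climb_Cons)

lemma dominates_staircase_0 [simp]: "dominates_staircase w 0"
  by (simp add: dominates_staircase_def)

text \<open>A staircase of length \<open>r\<close> in \<open>c # w\<close> either avoids the first position, or uses it for its highest
  step, which demands \<open>c > r - 1\<close> and leaves a staircase of length \<open>r - 1\<close> in \<open>w\<close>. This one-letter
  rule is what makes the greedy scan optimal.\<close>
lemma dominates_staircase_Cons:
  "dominates_staircase (c # w) r \<longleftrightarrow>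
    dominates_staircase w r \<or> (\<exists>r'. r = Suc r' \<and> r' < c \<and> dominates_staircase w r')"
    (is "?L \<longleftrightarrow> ?R")
proof
  assume ?L
  then obtain f where mono: "strict_mono_on {1..r} f"
    and ran: "f ` {1..r} \<subseteq> {1..length (c # w)}"
    and dom: "\<forall>j\<in>{1..r}. (c # w) ! (f j - 1) > r - j"
    by (auto simp: dominates_staircase_def)
  show ?R
  proof (cases "r = 0")
    case True
    then show ?thesis by simp
  next
    case False
    then obtain r' where r: "r = Suc r'" by (metis not0_implies_Suc)
    have pos: "1 \<le> f j" "f j \<le> Suc (length w)" if "j \<in> {1..r}" for j
      using ran[THEN subsetD, OF imageI, OF that] by auto
    have less: "f i < f j" if "1 \<le> i" "i < j" "j \<le> r" for i j
      using mono that by (simp add: strict_mono_on_def)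
    show ?thesis
    proof (cases "f 1 = 1")
      case True
      have c: "r' < c" using dom True r by force
      have big: "2 \<le> f (Suc j)" if "j \<in> {1..r'}" for j
        using less[of 1 "Suc j"] True that r by auto
      have "dominates_staircase w r'"
        unfolding dominates_staircase_def
      proof (intro exI[of _ "\<lambda>j. f (Suc j) - 1"] conjI ballI)
        show "strict_mono_on {1..r'} (\<lambda>j. f (Suc j) - 1)"
        proof (rule strict_mono_onI)
          fix i j assume "i \<in> {1..r'}" "j \<in> {1..r'}" "i < j"
          then show "f (Suc i) - 1 < f (Suc j) - 1"
            using less[of "Suc i" "Suc j"] big[of i] r by auto
        qed
        show "(\<lambda>j. f (Suc j) - 1) ` {1..r'} \<subseteq> {1..length w}"
        proof
          fix p assume "p \<in> (\<lambda>j. f (Suc j) - 1) ` {1..r'}"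
          then obtain j where "j \<in> {1..r'}" "p = f (Suc j) - 1" by blast
          then show "p \<in> {1..length w}" using big[of j] pos[of "Suc j"] r by auto
        qed
        fix j assume j: "j \<in> {1..r'}"
        then have "(c # w) ! (f (Suc j) - 1) > r - Suc j" using dom[rule_format, of "Suc j"] r by simp
        moreover obtain p where "f (Suc j) = Suc (Suc p)"
          using big[OF j] by (metis Suc_le_D numeral_2_eq_2 Suc_le_mono)
        ultimately show "w ! (f (Suc j) - 1 - 1) > r' - j" using r by simp
      qed
      then show ?thesis using r c by blast
    next
      case False
      have big: "2 \<le> f j" if "j \<in> {1..r}" for j
        using less[of 1 j] pos[of 1] False that r by (cases "j = 1") auto
      have "dominates_staircase w r"
        unfolding dominates_staircase_def
      proof (intro exI[of _ "\<lambda>j. f j - 1"] conjI ballI)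
        show "strict_mono_on {1..r} (\<lambda>j. f j - 1)"
        proof (rule strict_mono_onI)
          fix i j assume "i \<in> {1..r}" "j \<in> {1..r}" "i < j"
          then show "f i - 1 < f j - 1"
            using less[of i j] big[of i] by auto
        qed
        show "(\<lambda>j. f j - 1) ` {1..r} \<subseteq> {1..length w}"
        proof
          fix p assume "p \<in> (\<lambda>j. f j - 1) ` {1..r}"
          then obtain j where "j \<in> {1..r}" "p = f j - 1" by blast
          then show "p \<in> {1..length w}" using big[of j] pos[of j] by auto
        qed
        fix j assume j: "j \<in> {1..r}"
        then have "(c # w) ! (f j - 1) > r - j" using dom[rule_format, OF j] by simp
        moreover obtain p where "f j = Suc (Suc p)"
          using big[OF j] by (metis Suc_le_D numeral_2_eq_2 Suc_le_mono)
        ultimately show "w ! (f j - 1 - 1) > r - j" by simp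
      qed
      then show ?thesis by blast
    qed
  qed
next
  assume ?R
  then show ?L
  proof (elim disjE exE conjE)
    assume "dominates_staircase w r"
    then obtain f where mono: "strict_mono_on {1..r} f"
      and ran: "f ` {1..r} \<subseteq> {1..length w}"
      and dom: "\<forall>j\<in>{1..r}. w ! (f j - 1) > r - j"
      by (auto simp: dominates_staircase_def)
    show ?L
      unfolding dominates_staircase_def
    proof (intro exI[of _ "\<lambda>j. Suc (f j)"] conjI ballI)
      show "strict_mono_on {1..r} (\<lambda>j. Suc (f j))"
        using mono by (simp add: strict_mono_on_def)
      show "(\<lambda>j. Suc (f j)) ` {1..r} \<subseteq> {1..length (c # w)}"
        using ran by auto
      fix j assume j: "j \<in> {1..r}"
      then have "f j \<in> {1..length w}" using ran by blast
      then obtain p where "f j = Suc p" by (cases "f j") auto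
      then show "(c # w) ! (Suc (f j) - 1) > r - j" using dom[rule_format, OF j] by simp
    qed
  next
    fix r' assume r: "r = Suc r'" and c: "r' < c" and "dominates_staircase w r'"
    then obtain f where mono: "strict_mono_on {1..r'} f"
      and ran: "f ` {1..r'} \<subseteq> {1..length w}"
      and dom: "\<forall>j\<in>{1..r'}. w ! (f j - 1) > r' - j"
      by (auto simp: dominates_staircase_def)
    define g where "g j = (if j = 1 then 1 else Suc (f (j - 1)))" for j :: nat
    have split: "\<exists>i. j = Suc i \<and> i \<in> {1..r'} \<and> f i \<in> {1..length w}"
      if jr: "j \<in> {1..r}" "j \<noteq> 1" for j
    proof -
      obtain i where i: "j = Suc i" "i \<in> {1..r'}" using jr r by (cases j) auto
      then show ?thesis using ran by blast
    qed
    show ?L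
      unfolding dominates_staircase_def
    proof (intro exI[of _ g] conjI ballI)
      show "strict_mono_on {1..r} g"
      proof (rule strict_mono_onI)
        fix i j assume ij: "i \<in> {1..r}" "j \<in> {1..r}" "i < j"
        then obtain j' where j': "j = Suc j'" "j' \<in> {1..r'}" "f j' \<in> {1..length w}"
          using split[of j] by auto
        show "g i < g j"
        proof (cases "i = 1")
          case True
          then show ?thesis using j' by (simp add: g_def)
        next
          case False
          then obtain i' where i': "i = Suc i'" "i' \<in> {1..r'}"
            using split[of i] ij by auto
          then have "f i' < f j'" using strict_mono_onD[OF mono, of i' j'] ij j' by simp
          then show ?thesis using i' j' by (simp add: g_def)
        qed
      qed
      show "g ` {1..r} \<subseteq> {1..length (c # w)}"
      proof
        fix p assume "p \<in> g ` {1..r}"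
        then obtain j where "j \<in> {1..r}" "p = g j" by blast
        then show "p \<in> {1..length (c # w)}"
          using split[of j] by (cases "j = 1") (auto simp: g_def)
      qed
      fix j assume j: "j \<in> {1..r}"
      show "(c # w) ! (g j - 1) > r - j"
      proof (cases "j = 1")
        case False
        then obtain i where "j = Suc i" "i \<in> {1..r'}" "f i \<in> {1..length w}"
          using split[OF j] by blast
        then show ?thesis using dom[rule_format, of i] r by (simp add: g_def nth_Cons')
      qed (use c r in \<open>simp add: g_def\<close>)
    qed
  qed
qed

lemma dominates_staircase_iff: "dominates_staircase w r \<longleftrightarrow> r \<le> climb w 0"
proof (induction w arbitrary: r)
  case Nil
  have "r = 0" if "dominates_staircase [] r"
    using that by (auto simp: dominates_staircase_def)
  then show ?case by auto
next
  case (Cons c w)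
  show ?case
    unfolding dominates_staircase_Cons Cons climb_Cons by (cases r) auto
qed

lemma st_eq_climb: "st w = climb w 0"
proof (cases "climb w 0 = 0")
  case True
  then show ?thesis by (auto simp: st_def dominates_staircase_iff)
next
  case False
  have "climb w 0 \<in> {1..length w}"
    using False climb_le_length[of w] by simp
  moreover have "Max {r \<in> {1..length w}. r \<le> climb w 0} = climb w 0"
    by (rule Max_eqI) (use calculation in auto)
  ultimately show ?thesis
    by (auto simp: st_def dominates_staircase_iff)
qed

section \<open>Inserting the smallest letter\<close>

text \<open>The segment of the code of the inverse standardisation that belongs to the letter \<open>z\<close>.\<close>
definition letter_code :: "nat \<Rightarrow> nat list \<Rightarrow> nat list" where
  "letter_code z w =
    map (\<lambda>p. length (filter (\<lambda>a. z < a) (take p w))) (filter (\<lambda>p. w ! p = z) [0..<length w])"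

lemma letter_code_Nil [simp]: "letter_code z [] = []"
  by (simp add: letter_code_def)

lemma letter_code_snoc:
  "letter_code z (w @ [a])
    = letter_code z w @ (if a = z then [length (filter (\<lambda>a. z < a) w)] else [])"
proof -
  have "filter (\<lambda>p. (w @ [a]) ! p = z) [0..<length w] = filter (\<lambda>p. w ! p = z) [0..<length w]"
    by (rule filter_cong) (auto simp: nth_append)
  then show ?thesis by (auto simp: letter_code_def)
qed

text \<open>Letters below \<open>z\<close> do not influence the segment of \<open>z\<close>, hence deleting the smallest letter keeps
  the segments of all other letters.\<close>
lemma letter_code_filter:
  assumes "\<And>a. z \<le> a \<Longrightarrow> P a"
  shows "letter_code z (filter P w) = letter_code z w"
proof (induction w rule: rev_induct)
  case (snoc a w)
  have "filter (\<lambda>a. z < a) (filter P w) = filter (\<lambda>a. z < a) w"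
    using assms by (auto intro: filter_cong)
  then show ?case using snoc assms by (auto simp: letter_code_snoc)
qed simp

lemma letter_code_map_Suc: "letter_code (Suc z) (map Suc w) = letter_code z w"
  by (induction w rule: rev_induct) (simp_all add: letter_code_snoc filter_map o_def)

definition insertions :: "nat \<Rightarrow> nat \<Rightarrow> nat list \<Rightarrow> nat list set" where
  "insertions z b u = {w. filter (\<lambda>a. a \<noteq> z) w = u \<and> count_list w z = b}"

lemma insertions_length: "w \<in> insertions z b u \<Longrightarrow> length w = length u + b"
proof -
  have "length w = length (filter (\<lambda>a. a \<noteq> z) w) + count_list w z"
    by (induction w) auto
  then show "w \<in> insertions z b u \<Longrightarrow> length w = length u + b"
    by (auto simp: insertions_def)
qed

lemma finite_insertions: "finite (insertions z b u)"
proof (rule finite_subset)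
  show "insertions z b u \<subseteq> {w. set w \<subseteq> insert z (set u) \<and> length w = length u + b}"
    using insertions_length by (auto simp: insertions_def)
qed (simp add: finite_lists_length_eq)

lemma insertions_0: "z \<notin> set u \<Longrightarrow> insertions z 0 u = {u}"
proof -
  assume "z \<notin> set u"
  moreover have "filter (\<lambda>a. a \<noteq> z) w = w" if "z \<notin> set w" for w
    using that by (intro filter_True) auto
  ultimately show ?thesis by (auto simp: insertions_def count_list_0_iff)
qed

lemma insertions_Nil_Suc: "insertions z (Suc b) [] = (\<lambda>w. w @ [z]) ` insertions z b []"
proof (intro set_eqI iffI)
  fix w assume w: "w \<in> insertions z (Suc b) []"
  then have "w \<noteq> []" by (auto simp: insertions_def)
  then obtain v a where "w = v @ [a]" by (metis rev_exhaust)
  then show "w \<in> (\<lambda>w. w @ [z]) ` insertions z b []"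
    using w by (auto simp: insertions_def split: if_splits)
qed (auto simp: insertions_def)

lemma insertions_snoc_Suc:
  assumes "a \<noteq> z"
  shows "insertions z (Suc b) (u @ [a]) =
    (\<lambda>w. w @ [a]) ` insertions z (Suc b) u \<union> (\<lambda>w. w @ [z]) ` insertions z b (u @ [a])"
proof (intro set_eqI iffI)
  fix w assume w: "w \<in> insertions z (Suc b) (u @ [a])"
  then have "w \<noteq> []" by (auto simp: insertions_def)
  then obtain v c where "w = v @ [c]" by (metis rev_exhaust)
  then show "w \<in> (\<lambda>w. w @ [a]) ` insertions z (Suc b) u
      \<union> (\<lambda>w. w @ [z]) ` insertions z b (u @ [a])"
    using w by (auto simp: insertions_def split: if_splits)
qed (use assms in \<open>auto simp: insertions_def\<close>)

definition insertion_weight :: "nat \<Rightarrow> nat \<Rightarrow> nat \<Rightarrow> nat list \<Rightarrow> int poly fps" where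
  "insertion_weight z b s u =
    (\<Sum>w\<in>insertions z b u. fps_X ^ climb (letter_code z w) s * q_power (sum_list (letter_code z w)))"

lemma insertion_weight_0: "z \<notin> set u \<Longrightarrow> insertion_weight z 0 s u = fps_X ^ s"
proof -
  assume z: "z \<notin> set u"
  then have "letter_code z u = []"
    by (auto simp: letter_code_def filter_empty_conv)
  then show ?thesis by (simp add: insertion_weight_def insertions_0[OF z])
qed

lemma filter_greater_insertion:
  assumes "w \<in> insertions z b u" "\<forall>a\<in>set u. z < a"
  shows "length (filter (\<lambda>a. z < a) w) = length u"
proof -
  have "filter (\<lambda>a. z < a) w = filter (\<lambda>a. z < a) (filter (\<lambda>a. a \<noteq> z) w)"
    by (auto intro: filter_cong)
  also have "\<dots> = u" using assms by (auto simp: insertions_def)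
  finally show ?thesis by simp
qed

text \<open>A final \<open>z\<close> has all of \<open>u\<close> as larger letters to its left. It contributes \<open>length u\<close> to the sum
  of the code, and as the rightmost entry it is the first one that the scan compares with \<open>s\<close>.\<close>
lemma sum_insertions_ending_z:
  assumes "\<forall>a\<in>set u. z < a"
  shows "(\<Sum>w\<in>(\<lambda>w. w @ [z]) ` insertions z b u.
      fps_X ^ climb (letter_code z w) s * q_power (sum_list (letter_code z w)))
    = q_power (length u) * insertion_weight z b (if s < length u then Suc s else s) u"
proof -
  have "(\<Sum>w\<in>(\<lambda>w. w @ [z]) ` insertions z b u.
      fps_X ^ climb (letter_code z w) s * q_power (sum_list (letter_code z w)))
    = (\<Sum>w\<in>insertions z b u. fps_X ^ climb (letter_code z (w @ [z])) s
        * q_power (sum_list (letter_code z (w @ [z]))))"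
    by (subst sum.reindex) (auto simp: inj_on_def)
  also have "\<dots> = (\<Sum>w\<in>insertions z b u. q_power (length u) *
      (fps_X ^ climb (letter_code z w) (if s < length u then Suc s else s)
        * q_power (sum_list (letter_code z w))))"
    by (rule sum.cong)
      (simp_all add: letter_code_snoc filter_greater_insertion[OF _ assms] climb_append
        climb_Cons q_power_add ac_simps)
  finally show ?thesis by (simp add: insertion_weight_def sum_distrib_left)
qed

lemma insertion_weight_Nil_Suc:
  "insertion_weight z (Suc b) s [] = insertion_weight z b s []"
  using sum_insertions_ending_z[where u = "[]" and z = z and b = b and s = s]
  by (simp add: insertion_weight_def insertions_Nil_Suc)

lemma insertion_weight_snoc_Suc:
  assumes "\<forall>c\<in>set (u @ [a]). z < c"
  shows "insertion_weight z (Suc b) s (u @ [a]) = insertion_weight z (Suc b) s u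
    + q_power (Suc (length u)) * insertion_weight z b (if s \<le> length u then Suc s else s) (u @ [a])"
proof -
  let ?g = "\<lambda>w. fps_X ^ climb (letter_code z w) s * q_power (sum_list (letter_code z w))"
  let ?A = "(\<lambda>w. w @ [a]) ` insertions z (Suc b) u"
  let ?B = "(\<lambda>w. w @ [z]) ` insertions z b (u @ [a])"
  have az: "a \<noteq> z" using assms by auto
  have "insertion_weight z (Suc b) s (u @ [a]) = sum ?g (?A \<union> ?B)"
    by (simp add: insertion_weight_def insertions_snoc_Suc[OF az])
  also have "\<dots> = sum ?g ?A + sum ?g ?B"
    by (rule sum.union_disjoint) (use az in \<open>auto simp: finite_insertions\<close>)
  also have "sum ?g ?A = insertion_weight z (Suc b) s u"
    unfolding insertion_weight_def
    by (subst sum.reindex) (auto simp: inj_on_def letter_code_snoc az)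
  also have "sum ?g ?B = q_power (Suc (length u))
      * insertion_weight z b (if s \<le> length u then Suc s else s) (u @ [a])"
    using sum_insertions_ending_z[OF assms, where b = b and s = s] by (simp add: less_Suc_eq_le)
  finally show ?thesis .
qed

text \<open>No entry of the segment exceeds \<open>length u\<close>, so a scan that starts at a level \<open>s \<ge> length u\<close> stays
  there, and only the generating function of the sum of the segment remains.\<close>
lemma insertion_weight_low:
  assumes "\<forall>a\<in>set u. z < a" "length u \<le> s"
  shows "insertion_weight z b s u = fps_X ^ s * fps_const (gauss b (length u))"
  using assms
proof (induction b arbitrary: u)
  case 0
  then show ?case by (subst insertion_weight_0) auto
next
  case (Suc b u)
  from Suc.prems show ?case
  proof (induction u rule: rev_induct)
    case Nil
    then show ?case using Suc.IH[of "[]"] by (simp add: insertion_weight_Nil_Suc)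
  next
    case (snoc a u)
    have "insertion_weight z (Suc b) s (u @ [a])
        = fps_X ^ s * (fps_const (gauss (Suc b) (length u))
          + q_power (Suc (length u)) * fps_const (gauss b (Suc (length u))))"
      using snoc Suc.IH[of "u @ [a]"]
      by (simp add: insertion_weight_snoc_Suc distrib_left mult.left_commute)
    then show ?case
      by (simp add: gauss_Suc_Suc' q_power_def del: power_Suc)
  qed
qed

text \<open>The heart of the proof: how the insertion of \<open>b\<close> copies of a new smallest letter acts on one term
  of the generating function.\<close>
lemma insertion_weight_mult_gauss_series:
  assumes "\<forall>a\<in>set u. z < a" "s \<le> length u"
  shows "insertion_weight z b s u * gauss_series (length u + b)
    = gauss_scale b (fps_X ^ s * gauss_series (length u))"
  using assms
proof (induction b arbitrary: s u)
  case 0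
  then show ?case by (subst insertion_weight_0) (auto simp: gauss_scale_0)
next
  case (Suc b s u)
  from Suc.prems show ?case
  proof (induction u rule: rev_induct)
    case Nil
    then show ?case
      using gauss_scale_diagonal[of "Suc b" 0] by (simp add: insertion_weight_low)
  next
    case (snoc a u)
    let ?m = "length u"
    show ?case
    proof (cases "s = Suc ?m")
      case True
      then show ?thesis
        using snoc.prems gauss_scale_diagonal[of "Suc b" s]
        by (simp add: insertion_weight_low)
    next
      case False
      then have s: "s \<le> ?m" using snoc.prems by simp
      \<comment> \<open>Multiplying by the new factor of the denominator lowers the order of the series by one,
        so that both induction hypotheses apply; afterwards the factor is cancelled.\<close>
      let ?D = "1 - fps_X * q_power (Suc ?m + Suc b)"
      have D: "?D * gauss_series (Suc ?m + Suc b) = gauss_series (?m + Suc b)"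
        using gauss_series_Suc[of "Suc ?m + b"] by simp
      have "?D * (insertion_weight z (Suc b) s (u @ [a]) * gauss_series (Suc ?m + Suc b))
          = insertion_weight z (Suc b) s (u @ [a]) * gauss_series (?m + Suc b)"
        unfolding D[symmetric] by (simp only: ac_simps)
      also have "\<dots> = insertion_weight z (Suc b) s u * gauss_series (?m + Suc b)
          + q_power (Suc ?m) * (insertion_weight z b (Suc s) (u @ [a])
            * gauss_series (length (u @ [a]) + b))"
        using snoc.prems s by (simp add: insertion_weight_snoc_Suc distrib_right mult.assoc)
      also have "\<dots> = gauss_scale (Suc b) (fps_X ^ s * gauss_series ?m)
          + q_power (Suc ?m) * gauss_scale b (fps_X ^ Suc s * gauss_series (Suc ?m))"
        using snoc.IH snoc.prems s Suc.IH[of "u @ [a]" "Suc s"] by simp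
      also have "\<dots> = ?D * gauss_scale (Suc b) (fps_X ^ s * gauss_series (Suc ?m))"
        by (rule gauss_scale_recurrence[symmetric])
      finally show ?thesis
        using one_minus_X_q_nonzero by simp
    qed
  qed
qed

section \<open>The code of the inverse standardisation\<close>

definition positions :: "nat \<Rightarrow> nat list \<Rightarrow> nat list" where
  "positions z w = filter (\<lambda>p. w\<langle>p\<rangle> = z) [1..<Suc (length w)]"

definition word_code :: "nat \<Rightarrow> nat list \<Rightarrow> nat list" where
  "word_code m w = concat (map (\<lambda>z. letter_code z w) [1..<Suc m])"

lemma letter_code_positions:
  "letter_code z w = map (\<lambda>p. card {r. 1 \<le> r \<and> r < p \<and> z < w\<langle>r\<rangle>}) (positions z w)"
proof -
  have "positions z w = map Suc (filter (\<lambda>p. w ! p = z) [0..<length w])"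
    by (simp add: positions_def map_Suc_upt[symmetric] filter_map o_def del: upt_Suc)
  moreover have "length (filter (\<lambda>a. z < a) (take p w))
      = card {r. 1 \<le> r \<and> r < Suc p \<and> z < w\<langle>r\<rangle>}" if "p < length w" for p
  proof -
    have "{r. 1 \<le> r \<and> r < Suc p \<and> z < w\<langle>r\<rangle>} = Suc ` {i. i < p \<and> z < w ! i}"
    proof (intro set_eqI iffI)
      fix r assume "r \<in> {r. 1 \<le> r \<and> r < Suc p \<and> z < w\<langle>r\<rangle>}"
      then show "r \<in> Suc ` {i. i < p \<and> z < w ! i}" by (cases r) auto
    qed auto
    then have "card {r. 1 \<le> r \<and> r < Suc p \<and> z < w\<langle>r\<rangle>} = card {i. i < p \<and> z < w ! i}"
      by (simp add: card_image)
    moreover have "{i. i < length (take p w) \<and> z < take p w ! i} = {i. i < p \<and> z < w ! i}"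
      using that by auto
    ultimately show ?thesis by (simp add: length_filter_conv_card)
  qed
  ultimately show ?thesis
    by (auto simp: letter_code_def)
qed

text \<open>The elements of a filtered interval have ranks 1, 2, 3, and so on. For the positions of a letter
  this says that standardisation numbers its occurrences consecutively.\<close>
lemma map_rank_filter:
  "map (\<lambda>p. card {j\<in>{1..p}. P j}) (filter P [1..<Suc n]) = [1..<Suc (card {j\<in>{1..n}. P j})]"
proof (induction n)
  case (Suc n)
  have "{j\<in>{1..Suc n}. P j}
      = (if P (Suc n) then insert (Suc n) {j\<in>{1..n}. P j} else {j\<in>{1..n}. P j})"
    by (auto simp: le_Suc_eq)
  then have "card {j\<in>{1..Suc n}. P j}
      = (if P (Suc n) then Suc (card {j\<in>{1..n}. P j}) else card {j\<in>{1..n}. P j})"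
    by simp
  then show ?case using Suc by simp
qed simp

lemma multiset_words_iff:
  "w \<in> multiset_words \<rho> \<longleftrightarrow>
    (\<forall>a. count_list w a = (if 1 \<le> a \<and> a \<le> length \<rho> then \<rho>\<langle>a\<rangle> else 0))"
  by (simp add: multiset_words_def permutations_of_multiset_def multiset_eq_iff count_sum
      count_mset sum.delta' cong: if_cong)

lemma multiset_words_letters:
  assumes "w \<in> multiset_words \<rho>" "a \<in> set w"
  shows "1 \<le> a" "a \<le> length \<rho>"
  using assms by (auto simp: multiset_words_iff count_list_0_iff split: if_splits)

lemma sum_list_entries: "sum_list \<rho> = (\<Sum>j = 1..<Suc (length \<rho>). \<rho>\<langle>j\<rangle>)"
  unfolding sum_list_sum_nth One_nat_def sum.atLeast_Suc_lessThan_Suc_shift by simp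

lemma length_multiset_words:
  assumes "w \<in> multiset_words \<rho>"
  shows "length w = sum_list \<rho>"
proof -
  have "length w = sum (count_list w) {1..<Suc (length \<rho>)}"
    by (rule sum_count_set[symmetric])
      (use multiset_words_letters[OF assms] in \<open>auto simp: less_Suc_eq_le\<close>)
  also have "\<dots> = (\<Sum>j = 1..<Suc (length \<rho>). \<rho>\<langle>j\<rangle>)"
    using assms by (intro sum.cong) (auto simp: multiset_words_iff)
  finally show ?thesis by (simp only: sum_list_entries)
qed

lemma card_entries_eq: "card {j\<in>{1..length w}. w\<langle>j\<rangle> = a} = count_list w a"
proof -
  have "{j\<in>{1..length w}. w\<langle>j\<rangle> = a} = Suc ` {i. i < length w \<and> a = w ! i}"
  proof (intro set_eqI iffI)
    fix r assume "r \<in> {j\<in>{1..length w}. w\<langle>j\<rangle> = a}"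
    then show "r \<in> Suc ` {i. i < length w \<and> a = w ! i}" by (cases r) auto
  qed auto
  then show ?thesis
    by (simp add: card_image count_list_eq_length_filter length_filter_conv_card)
qed

lemma concat_upt_segments:
  fixes f :: "nat \<Rightarrow> nat"
  shows "concat (map (\<lambda>a. [Suc (\<Sum>b = 1..<a. f b)..<Suc (\<Sum>b = 1..<Suc a. f b)]) [1..<Suc m])
    = [1..<Suc (\<Sum>b = 1..<Suc m. f b)]"
proof (induction m)
  case (Suc m)
  let ?s = "\<Sum>b = 1..<Suc m. f b"
  have "[1..<Suc ?s + f (Suc m)] = [1..<Suc ?s] @ [Suc ?s..<Suc ?s + f (Suc m)]"
    by (rule upt_add_eq_append) simp
  moreover have "(\<Sum>b = 1..<Suc (Suc m). f b) = ?s + f (Suc m)" by simp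
  moreover have "[1..<Suc (Suc m)] = [1..<Suc m] @ [Suc m]" by simp
  ultimately show ?case using Suc by (simp only: map_append concat_append) simp
qed simp

lemma map_std_positions:
  assumes "w \<in> multiset_words \<rho>" "1 \<le> a" "a \<le> length \<rho>"
  shows "map (std \<rho> w) (positions a w)
    = [Suc (\<Sum>b = 1..<a. \<rho>\<langle>b\<rangle>)..<Suc (\<Sum>b = 1..<Suc a. \<rho>\<langle>b\<rangle>)]"
proof -
  let ?s = "\<Sum>b = 1..<a. \<rho>\<langle>b\<rangle>"
  have "map (std \<rho> w) (positions a w)
      = map (\<lambda>t. ?s + t) (map (\<lambda>p. card {j\<in>{1..p}. w\<langle>j\<rangle> = a}) (positions a w))"
    by (auto simp: positions_def std_def)
  also have "\<dots> = map (\<lambda>t. ?s + t) [1..<Suc (\<rho>\<langle>a\<rangle>)]"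
    unfolding positions_def map_rank_filter card_entries_eq
    using assms by (simp add: multiset_words_iff del: upt_Suc)
  also have "\<dots> = [Suc ?s..<Suc (?s + \<rho>\<langle>a\<rangle>)]"
    by (rule nth_equalityI) (simp_all del: upt_Suc)
  finally show ?thesis using assms by simp
qed

text \<open>Listing all positions letter by letter sorts them by their standardised value. So this list is the
  one-line notation of \<open>istd w\<close>; it also yields that the standardisation is a permutation.\<close>
lemma map_std_all_positions:
  assumes "w \<in> multiset_words \<rho>"
  shows "map (std \<rho> w) (concat (map (\<lambda>a. positions a w) [1..<Suc (length \<rho>)]))
    = [1..<Suc (length w)]"
proof -
  have "map (std \<rho> w) (concat (map (\<lambda>a. positions a w) [1..<Suc (length \<rho>)]))
      = concat (map (\<lambda>a. map (std \<rho> w) (positions a w)) [1..<Suc (length \<rho>)])"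
    by (simp only: map_concat map_map o_def)
  also have "\<dots> = concat (map (\<lambda>a.
      [Suc (\<Sum>b = 1..<a. \<rho>\<langle>b\<rangle>)..<Suc (\<Sum>b = 1..<Suc a. \<rho>\<langle>b\<rangle>)]) [1..<Suc (length \<rho>)])"
    by (intro arg_cong[of _ _ concat] map_cong refl map_std_positions[OF assms]) auto
  also have "\<dots> = [1..<Suc (length w)]"
    unfolding concat_upt_segments length_multiset_words[OF assms] sum_list_entries ..
  finally show ?thesis .
qed

lemma set_all_positions:
  assumes "w \<in> multiset_words \<rho>"
  shows "set (concat (map (\<lambda>a. positions a w) [1..<Suc (length \<rho>)])) = {1..length w}"
proof -
  have "1 \<le> w\<langle>p\<rangle> \<and> w\<langle>p\<rangle> \<le> length \<rho>" if "p \<in> {1..length w}" for p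
  proof -
    have "w\<langle>p\<rangle> \<in> set w" using that by (intro nth_mem) auto
    then show ?thesis using multiset_words_letters[OF assms] by blast
  qed
  then show ?thesis
    by (auto simp: positions_def less_Suc_eq_le simp del: upt_Suc)
qed

lemma distinct_all_positions:
  assumes "w \<in> multiset_words \<rho>"
  shows "distinct (concat (map (\<lambda>a. positions a w) [1..<Suc (length \<rho>)]))"
  using map_std_all_positions[OF assms] by (metis distinct_map distinct_upt)

lemma std_permutes:
  assumes "w \<in> multiset_words \<rho>"
  shows "std \<rho> w permutes {1..length w}"
proof (rule bij_imp_permutes)
  let ?L = "concat (map (\<lambda>a. positions a w) [1..<Suc (length \<rho>)])"
  have "inj_on (std \<rho> w) (set ?L)"
    using map_std_all_positions[OF assms] by (metis distinct_map distinct_upt)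
  moreover have "std \<rho> w ` set ?L = {1..length w}"
    unfolding set_map[symmetric] map_std_all_positions[OF assms] by auto
  ultimately show "bij_betw (std \<rho> w) {1..length w} {1..length w}"
    unfolding bij_betw_def set_all_positions[OF assms] by blast
  show "std \<rho> w i = i" if "i \<notin> {1..length w}" for i
    using that by (auto simp: std_def)
qed

text \<open>Standardisation keeps the order between different letters and makes equal letters increase from left
  to right, so it creates no inversions and destroys none.\<close>
lemma std_less_iff:
  assumes w: "w \<in> multiset_words \<rho>" and rp: "1 \<le> r" "r < p" "p \<le> length w"
  shows "std \<rho> w p < std \<rho> w r \<longleftrightarrow> w\<langle>p\<rangle> < w\<langle>r\<rangle>"
proof -
  let ?s = "\<lambda>a. \<Sum>b = 1..<a. \<rho>\<langle>b\<rangle>"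
  let ?k = "\<lambda>i. card {j\<in>{1..i}. w\<langle>j\<rangle> = w\<langle>i\<rangle>}"
  have std: "std \<rho> w i = ?s (w\<langle>i\<rangle>) + ?k i" if "1 \<le> i" "i \<le> length w" for i
    using that by (simp add: std_def)
  have pos: "0 < ?k i" if "1 \<le> i" for i
  proof -
    have "i \<in> {j\<in>{1..i}. w\<langle>j\<rangle> = w\<langle>i\<rangle>}" using that by simp
    then show ?thesis by (subst card_gt_0_iff) auto
  qed
  have less: "std \<rho> w i < std \<rho> w j"
    if "w\<langle>i\<rangle> < w\<langle>j\<rangle>" "1 \<le> i" "i \<le> length w" "1 \<le> j" "j \<le> length w" for i j
  proof -
    have letter: "1 \<le> w\<langle>i\<rangle>" "w\<langle>i\<rangle> \<le> length \<rho>"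
      using multiset_words_letters[OF w, of "w\<langle>i\<rangle>"] that by simp_all
    have "?k i \<le> card {j\<in>{1..length w}. w\<langle>j\<rangle> = w\<langle>i\<rangle>}"
      using that by (intro card_mono) auto
    also have "\<dots> = \<rho>\<langle>w\<langle>i\<rangle>\<rangle>"
      using w letter by (simp only: card_entries_eq multiset_words_iff) simp
    finally have "?s (w\<langle>i\<rangle>) + ?k i \<le> ?s (Suc (w\<langle>i\<rangle>))" using letter by simp
    also have "\<dots> \<le> ?s (w\<langle>j\<rangle>)"
      using that by (intro sum_mono2) auto
    finally show ?thesis using std that pos[of j] by simp
  qed
  have eq: "std \<rho> w r < std \<rho> w p" if "w\<langle>r\<rangle> = w\<langle>p\<rangle>"
  proof -
    have "?k r < ?k p"
    proof (rule psubset_card_mono)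
      have "p \<in> {j\<in>{1..p}. w\<langle>j\<rangle> = w\<langle>p\<rangle>}" "p \<notin> {j\<in>{1..r}. w\<langle>j\<rangle> = w\<langle>r\<rangle>}"
        using rp by auto
      moreover have "{j\<in>{1..r}. w\<langle>j\<rangle> = w\<langle>r\<rangle>} \<subseteq> {j\<in>{1..p}. w\<langle>j\<rangle> = w\<langle>p\<rangle>}"
        using rp that by auto
      ultimately show "{j\<in>{1..r}. w\<langle>j\<rangle> = w\<langle>r\<rangle>} \<subset> {j\<in>{1..p}. w\<langle>j\<rangle> = w\<langle>p\<rangle>}" by blast
    qed simp
    then show ?thesis using std that rp by simp
  qed
  show ?thesis
    using less[of r p] less[of p r] eq rp by (cases "w\<langle>p\<rangle>" "w\<langle>r\<rangle>" rule: linorder_cases) auto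
qed

lemma word_code_positions:
  "word_code m w = map (\<lambda>p. card {r. 1 \<le> r \<and> r < p \<and> w\<langle>p\<rangle> < w\<langle>r\<rangle>})
    (concat (map (\<lambda>a. positions a w) [1..<Suc m]))"
proof -
  have "letter_code z w = map (\<lambda>p. card {r. 1 \<le> r \<and> r < p \<and> w\<langle>p\<rangle> < w\<langle>r\<rangle>}) (positions z w)" for z
    unfolding letter_code_positions by (auto simp: positions_def)
  then show ?thesis by (simp add: word_code_def map_concat o_def del: upt_Suc)
qed

text \<open>With \<open>p = istd w i\<close>, the entry of the code at \<open>i\<close> counts the positions \<open>r < p\<close> with
  \<open>std w r > std w p\<close>, that is, the larger letters to the left of \<open>p\<close>.\<close>
lemma perm_code_istd:
  assumes w: "w \<in> multiset_words \<rho>"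
  shows "perm_code (length w) (istd \<rho> w) = word_code (length \<rho>) w"
proof -
  let ?N = "length w" and ?s = "std \<rho> w"
  let ?L = "concat (map (\<lambda>a. positions a w) [1..<Suc (length \<rho>)])"
  let ?f = "\<lambda>i. card {j. i < j \<and> j \<le> ?N \<and> inv ?s i > inv ?s j}"
  have perm: "?s permutes {1..?N}" by (rule std_permutes[OF w])
  have inv_s: "inv ?s (?s p) = p" for p
    using perm by (rule permutes_inverses)
  have "?f (?s p) = card {r. 1 \<le> r \<and> r < p \<and> w\<langle>p\<rangle> < w\<langle>r\<rangle>}" if p: "p \<in> {1..?N}" for p
  proof -
    have "{j. ?s p < j \<and> j \<le> ?N \<and> inv ?s (?s p) > inv ?s j}
        = ?s ` {r. 1 \<le> r \<and> r < p \<and> w\<langle>p\<rangle> < w\<langle>r\<rangle>}" (is "?A = _ ` ?B")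
    proof (intro set_eqI iffI)
      fix j assume j: "j \<in> ?A"
      define r where "r = inv ?s j"
      have sr: "?s r = j"
        using perm by (simp add: r_def permutes_inverses)
      have "j \<in> {1..?N}" using j by auto
      then have "r \<in> {1..?N}" using permutes_in_image[OF perm, of r] sr by simp
      then show "j \<in> ?s ` ?B"
        using j p sr std_less_iff[OF w, of r p] by (auto simp: inv_s r_def[symmetric])
    next
      fix j assume "j \<in> ?s ` ?B"
      then obtain r where r: "r \<in> ?B" "j = ?s r" by blast
      then have "?s r \<in> {1..?N}" using permutes_in_image[OF perm, of r] p by auto
      then show "j \<in> ?A" using r p std_less_iff[OF w, of r p] by (auto simp: inv_s)
    qed
    moreover have "inj_on ?s ?B" by (rule inj_on_subset[OF permutes_inj[OF perm]]) simp
    ultimately show ?thesis by (simp add: card_image)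
  qed
  then have "map (\<lambda>p. ?f (?s p)) ?L = word_code (length \<rho>) w"
    unfolding word_code_positions using set_all_positions[OF w] by (intro map_cong) auto
  moreover have "perm_code ?N (istd \<rho> w) = map ?f (map ?s ?L)"
    unfolding map_std_all_positions[OF w] by (simp add: perm_code_def istd_def)
  ultimately show ?thesis by (simp add: o_def)
qed

lemma mstc_eq_climb:
  assumes "w \<in> multiset_words \<rho>"
  shows "mstc \<rho> w = climb (word_code (length \<rho>) w) 0"
  by (simp add: mstc_def stc_def st_eq_climb perm_code_istd[OF assms]
      length_multiset_words[OF assms, symmetric])

lemma word_inv_eq_sum_list:
  assumes w: "w \<in> multiset_words \<rho>"
  shows "word_inv w = sum_list (word_code (length \<rho>) w)"
proof -
  let ?B = "\<lambda>p. {r. 1 \<le> r \<and> r < p \<and> w\<langle>p\<rangle> < w\<langle>r\<rangle>}"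
  have "sum_list (word_code (length \<rho>) w) = (\<Sum>p\<in>{1..length w}. card (?B p))"
    unfolding word_code_positions
    by (subst sum_list_distinct_conv_sum_set[OF distinct_all_positions[OF w]])
      (simp only: set_all_positions[OF w])
  also have "\<dots> = card (SIGMA p:{1..length w}. ?B p)"
    by (rule card_SigmaI[symmetric]) auto
  also have "\<dots> = card (prod.swap ` (SIGMA p:{1..length w}. ?B p))"
    by (rule card_image[symmetric]) simp
  also have "prod.swap ` (SIGMA p:{1..length w}. ?B p)
      = {(i, j). 1 \<le> i \<and> i < j \<and> j \<le> length w \<and> w\<langle>i\<rangle> > w\<langle>j\<rangle>}"
    by (auto simp: image_iff)
  finally show ?thesis by (simp add: word_inv_def)
qed

section \<open>Removing the smallest letter\<close>

lemma count_list_filter: "count_list (filter P w) a = (if P a then count_list w a else 0)"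
  by (induction w) auto

lemma count_list_map_Suc: "count_list (map Suc v) (Suc a) = count_list v a"
  by (induction v) auto

text \<open>A word is determined by its subword of letters other than 1 together with the places of the 1s; the
  subword, with all letters lowered by 1, is a word for the remaining parts.\<close>
lemma multiset_words_Cons:
  "multiset_words (b # \<rho>) = (\<Union>v\<in>multiset_words \<rho>. insertions 1 b (map Suc v))"
proof (intro set_eqI iffI)
  fix w assume w: "w \<in> multiset_words (b # \<rho>)"
  let ?u = "filter (\<lambda>a. a \<noteq> 1) w" and ?v = "map (\<lambda>a. a - 1) (filter (\<lambda>a. a \<noteq> 1) w)"
  have u: "map Suc ?v = ?u"
    unfolding map_map
  proof (rule map_idI)
    fix a assume "a \<in> set ?u"
    then show "(Suc \<circ> (\<lambda>a. a - 1)) a = a" using multiset_words_letters(1)[OF w, of a] by simp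
  qed
  have "count_list ?v a = (if 1 \<le> a \<and> a \<le> length \<rho> then \<rho>\<langle>a\<rangle> else 0)" for a
  proof -
    have "count_list ?v a = count_list ?u (Suc a)"
      using count_list_map_Suc[of ?v a, unfolded u] by (rule sym)
    then show ?thesis
      using w by (cases a) (auto simp: count_list_filter multiset_words_iff)
  qed
  then have "?v \<in> multiset_words \<rho>" by (simp add: multiset_words_iff)
  moreover have "w \<in> insertions 1 b (map Suc ?v)"
    using w unfolding u by (simp add: insertions_def multiset_words_iff)
  ultimately show "w \<in> (\<Union>v\<in>multiset_words \<rho>. insertions 1 b (map Suc v))" by blast
next
  fix w assume "w \<in> (\<Union>v\<in>multiset_words \<rho>. insertions 1 b (map Suc v))"
  then obtain v where v: "v \<in> multiset_words \<rho>"
    and w: "filter (\<lambda>a. a \<noteq> 1) w = map Suc v" "count_list w 1 = b"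
    by (auto simp: insertions_def)
  have "count_list w a = (if 1 \<le> a \<and> a \<le> length (b # \<rho>) then (b # \<rho>)\<langle>a\<rangle> else 0)" for a
  proof (cases "a = 1")
    case False
    then have "count_list w a = count_list (map Suc v) a"
      unfolding w(1)[symmetric] count_list_filter by simp
    also have "\<dots> = (case a of 0 \<Rightarrow> 0 | Suc c \<Rightarrow> count_list v c)"
      by (cases a) (auto simp: count_list_map_Suc count_list_0_iff)
    finally show ?thesis
      using v False by (auto simp: multiset_words_iff split: nat.split)
  qed (use w in simp)
  then show "w \<in> multiset_words (b # \<rho>)" by (simp add: multiset_words_iff)
qed

lemma word_code_insertion:
  assumes "w \<in> insertions 1 b (map Suc v)"
  shows "word_code (Suc m) w = letter_code 1 w @ word_code m v"
proof -
  have "letter_code (Suc z) w = letter_code z v" if "1 \<le> z" for z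
  proof -
    have "letter_code (Suc z) w = letter_code (Suc z) (filter (\<lambda>a. a \<noteq> 1) w)"
      using that by (intro letter_code_filter[symmetric]) auto
    then show ?thesis using assms by (simp add: insertions_def letter_code_map_Suc)
  qed
  then have "map (\<lambda>z. letter_code z w) (map Suc [1..<Suc m]) = map (\<lambda>z. letter_code z v) [1..<Suc m]"
    by (simp del: upt_Suc)
  moreover have "[1..<Suc (Suc m)] = 1 # map Suc [1..<Suc m]"
    by (simp add: map_Suc_upt upt_conv_Cons del: upt_Suc)
  ultimately show ?thesis unfolding word_code_def by (simp only: list.map concat.simps)
qed

lemma sum_multiset_words_Cons:
  "(\<Sum>w\<in>multiset_words (b # \<rho>). f w)
    = (\<Sum>v\<in>multiset_words \<rho>. \<Sum>w\<in>insertions 1 b (map Suc v). f w)"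
  unfolding multiset_words_Cons
proof (rule sum.UNION_disjoint)
  show "finite (multiset_words \<rho>)" by (simp add: multiset_words_def)
  show "\<forall>v\<in>multiset_words \<rho>. finite (insertions 1 b (map Suc v))"
    by (simp add: finite_insertions)
  show "\<forall>v\<in>multiset_words \<rho>. \<forall>v'\<in>multiset_words \<rho>. v \<noteq> v' \<longrightarrow>
      insertions 1 b (map Suc v) \<inter> insertions 1 b (map Suc v') = {}"
    by (auto simp: insertions_def)
qed

text \<open>The theorem in terms of codes, by induction on the number of parts: \<open>gauss_scale b\<close> is linear, so
  the insertion formula for each single term carries over to the whole generating function.\<close>
lemma word_code_generating_function:
  "(\<Sum>w\<in>multiset_words \<rho>. fps_X ^ climb (word_code (length \<rho>) w) 0
        * q_power (sum_list (word_code (length \<rho>) w))) * gauss_series (sum_list \<rho>)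
    = Abs_fps (\<lambda>k. \<Prod>j = 1..length \<rho>. gauss (\<rho>\<langle>j\<rangle>) k)"
proof (induction \<rho>)
  case Nil
  have "multiset_words [] = {[]}"
    by (simp add: multiset_words_def)
  moreover have "gauss_series 0 = Abs_fps (\<lambda>k. 1)"
    by (rule fps_ext) (simp add: gauss_series_def)
  ultimately show ?case
    by (simp add: word_code_def)
next
  case (Cons b \<rho>)
  let ?m = "length \<rho>" and ?M = "sum_list \<rho>"
  let ?s = "\<lambda>v. climb (word_code ?m v) 0" and ?i = "\<lambda>v. sum_list (word_code ?m v)"
  have inner: "(\<Sum>w\<in>insertions 1 b (map Suc v). fps_X ^ climb (word_code (Suc ?m) w) 0
        * q_power (sum_list (word_code (Suc ?m) w))) * gauss_series (?M + b)
      = gauss_scale b (fps_X ^ ?s v * q_power (?i v) * gauss_series ?M)"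
    if v: "v \<in> multiset_words \<rho>" for v
  proof -
    have len: "length (map Suc v) = ?M" using length_multiset_words[OF v] by simp
    have "?s v \<le> ?M"
    proof -
      have "length (word_code ?m v) = length (perm_code (length v) (istd \<rho> v))"
        by (simp only: perm_code_istd[OF v])
      also have "\<dots> = ?M" using len by (simp add: perm_code_def del: upt_Suc)
      finally show ?thesis using climb_le_length[of "word_code ?m v"] by simp
    qed
    moreover have "\<forall>a\<in>set (map Suc v). 1 < a"
      using multiset_words_letters[OF v] by fastforce
    ultimately have *: "insertion_weight 1 b (?s v) (map Suc v) * gauss_series (?M + b)
        = gauss_scale b (fps_X ^ ?s v * gauss_series ?M)"
      using insertion_weight_mult_gauss_series[of "map Suc v" 1 "?s v" b] len by simp
    have "(\<Sum>w\<in>insertions 1 b (map Suc v). fps_X ^ climb (word_code (Suc ?m) w) 0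
        * q_power (sum_list (word_code (Suc ?m) w)))
      = (\<Sum>w\<in>insertions 1 b (map Suc v). q_power (?i v)
        * (fps_X ^ climb (letter_code 1 w) (?s v) * q_power (sum_list (letter_code 1 w))))"
      by (rule sum.cong) (simp_all add: word_code_insertion climb_append q_power_add ac_simps)
    also have "\<dots> = q_power (?i v) * insertion_weight 1 b (?s v) (map Suc v)"
      by (simp add: insertion_weight_def sum_distrib_left)
    finally have "(\<Sum>w\<in>insertions 1 b (map Suc v). fps_X ^ climb (word_code (Suc ?m) w) 0
        * q_power (sum_list (word_code (Suc ?m) w))) * gauss_series (?M + b)
      = q_power (?i v) * gauss_scale b (fps_X ^ ?s v * gauss_series ?M)"
      by (simp only: mult.assoc *)
    also have "\<dots> = gauss_scale b (fps_X ^ ?s v * q_power (?i v) * gauss_series ?M)"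
      by (simp only: gauss_scale_q_power[symmetric] ac_simps)
    finally show ?thesis .
  qed
  have "(\<Sum>w\<in>multiset_words (b # \<rho>). fps_X ^ climb (word_code (length (b # \<rho>)) w) 0
        * q_power (sum_list (word_code (length (b # \<rho>)) w))) * gauss_series (sum_list (b # \<rho>))
      = (\<Sum>v\<in>multiset_words \<rho>. gauss_scale b (fps_X ^ ?s v * q_power (?i v) * gauss_series ?M))"
    unfolding sum_multiset_words_Cons sum_distrib_right
    using inner by (intro sum.cong) (simp_all add: sum_distrib_right add.commute)
  also have "\<dots> = gauss_scale b (Abs_fps (\<lambda>k. \<Prod>j = 1..length \<rho>. gauss (\<rho>\<langle>j\<rangle>) k))"
    by (simp only: gauss_scale_sum[symmetric] sum_distrib_right[symmetric] Cons.IH)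
  also have "\<dots> = Abs_fps (\<lambda>k. \<Prod>j = 1..length (b # \<rho>). gauss ((b # \<rho>)\<langle>j\<rangle>) k)"
  proof -
    have "(\<Prod>j = 1..length (b # \<rho>). gauss ((b # \<rho>)\<langle>j\<rangle>) k)
        = gauss b k * (\<Prod>j = 1..length \<rho>. gauss (\<rho>\<langle>j\<rangle>) k)" for k
      by (simp only: One_nat_def prod.atLeast1_atMost_eq length_Cons prod.lessThan_Suc_shift) simp
    then show ?thesis by (intro fps_ext) (simp add: gauss_scale_def mult.commute)
  qed
  finally show ?case .
qed

theorem theorem2p6:
  fixes N :: nat and \<rho> :: "nat list"
  assumes "is_composition \<rho> N"
  shows "Abs_fps (\<lambda>k. \<Prod>j=1..length \<rho>. qbinom (\<rho>\<langle>j\<rangle> + k) k) =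
         (\<Sum>w\<in>multiset_words \<rho>. fps_X ^ mstc \<rho> w * fps_const (qvar ^ word_inv w))
           * inverse_denom N"
proof -
  have "N = sum_list \<rho>" using assms by (simp add: is_composition_def)
  then show ?thesis
    using word_code_generating_function[of \<rho>]
    by (simp add: mstc_eq_climb word_inv_eq_sum_list inverse_denom_eq_gauss_series
        gauss_def q_power_def cong: sum.cong)
qed

end
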